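(* The $2$-bridge knot $8_9$ and the $3$-bridge knot $4_1\#4_1$ (the connected sum of two copies of the figure-eight knot $4_1$) have the same Jones polynomial but different HOMFLY polynomials: $P(8_9)\neq P(4_1\#4_1)$.
   Context: The knots are named as in the standard (Rolfsen) knot table. The HOMFLY polynomial $P(L)=P_L(a,m)\in\mathbb{Z}[a^{\pm1},m^{\pm1}]$ is the isotopy invariant of oriented links in $S^3$ with $P(\text{unknot})=1$ and $a\,P(L_+)+a^{-1}P(L_-)+m\,P(L_0)=0$, where $L_+,L_-,L_0$ are diagrams identical except near one crossing, which is respectively a positive crossing, a negative crossing, and the orientation-respecting smoothing. The Jones polynomial is the usual one, obtained from the writhe-normalized Kauffman bracket. Plat description of the knots: consider $4$-string braids with positions $0,1,2,3$ from left to right, the string in position $0$ being straight, with $\sigma_1$ a crossing of positions $1,2$ and $\sigma_2$ a crossing of positions $2,3$ (words read from top to bottom). The plat $p_4(w)$ is obtained from the braid $w$ by joining positions $0,1$ and positions $2,3$ by crossingless unlinked arcs both at the top and at the bottom. Then $8_9=p_4(\sigma_1^{-3}\sigma_2\sigma_1^{-1}\sigma_2^{2}\sigma_1^{-1})$ and $4_1=p_4(\sigma_1^{-1}\sigma_2\sigma_1^{-2})$. The bridge number of a knot $K$ is the smallest $n$ such that $K$ has a plat presentation on $2n$ strings; an $n$-bridge knot is a knot of bridge number $n$. *)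

theory Defs
  imports Complex_Main "HOL-Library.Poly_Mapping" "HOL-Library.Product_Plus"
begin

text \<open>
  Link diagrams are sliced by horizontal lines, so that each slice contains exactly one cap (local
  maximum), cup (local minimum) or crossing besides vertical strands.  A diagram is the list of its
  slices from top to bottom; a slice \<open>(i, p)\<close> has \<open>i\<close> vertical strands to the left of the
  piece \<open>p\<close>, positions being counted from 0.

  Reading downwards, \<open>Cap\<close> creates two strands at positions \<open>i\<close> and \<open>i + 1\<close>, and \<open>Cup\<close> joins and
  ends them.  In \<open>Cross True\<close> the strand from top right
  to bottom left passes over, in \<open>Cross False\<close> the strand from top left to bottom right.

  The label of a cap carries the orientation.  In a \<open>bool diagram\<close> (an oriented diagram) it is the
  direction of the left strand of the cap, \<open>True\<close> meaning downwards; this determines the direction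
  of every strand.  A \<open>unit diagram\<close> is an unoriented diagram.
\<close>

datatype 'd piece = Cap 'd | Cup | Cross bool

type_synonym 'd diagram = "(nat \<times> 'd piece) list"

fun ins :: "'d piece \<Rightarrow> nat" where
  "ins (Cap d) = 0"
| "ins Cup = 2"
| "ins (Cross s) = 2"

fun outs :: "'d piece \<Rightarrow> nat" where
  "outs (Cap d) = 2"
| "outs Cup = 0"
| "outs (Cross s) = 2"

definition forget_orientation :: "'d diagram \<Rightarrow> unit diagram" where
  "forget_orientation D = map (map_prod id (map_piece (\<lambda>_. ()))) D"

text \<open>
  \<open>through D xs\<close> is the list of strand directions below \<open>D\<close>, given the directions \<open>xs\<close> above it;
  it is \<open>None\<close> if a piece does not fit or a cup joins two strands of equal direction.
\<close>

fun through_slice :: "nat \<times> bool piece \<Rightarrow> bool list \<Rightarrow> bool list option" where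
  "through_slice (i, Cap d) xs =
     (if i \<le> length xs then Some (take i xs @ [d, \<not> d] @ drop i xs) else None)"
| "through_slice (i, Cup) xs =
     (if i + 1 < length xs \<and> xs ! i \<noteq> xs ! (i + 1)
      then Some (take i xs @ drop (i + 2) xs) else None)"
| "through_slice (i, Cross s) xs =
     (if i + 1 < length xs
      then Some (take i xs @ [xs ! (i + 1), xs ! i] @ drop (i + 2) xs) else None)"

fun through :: "bool diagram \<Rightarrow> bool list \<Rightarrow> bool list option" where
  "through [] xs = Some xs"
| "through (p # D) xs = Option.bind (through_slice p xs) (through D)"

definition link_diagram :: "bool diagram \<Rightarrow> bool" where
  "link_diagram D \<longleftrightarrow> through D [] = Some []"

definition orientation_of :: "bool diagram \<Rightarrow> unit diagram \<Rightarrow> bool" where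
  "orientation_of D U \<longleftrightarrow> link_diagram D \<and> forget_orientation D = U"

text \<open>
  Number of closed curves: sweeping downwards, \<open>xs\<close> labels the strands by the component they belong
  to as far as visible, and \<open>n\<close> is the next fresh label.  A cup either closes a component or merges
  two labels.
\<close>

fun closed_curves :: "nat \<Rightarrow> nat list \<Rightarrow> 'd diagram \<Rightarrow> nat" where
  "closed_curves n xs [] = 0"
| "closed_curves n xs ((i, Cap d) # D) =
     closed_curves (n + 1) (take i xs @ [n, n] @ drop i xs) D"
| "closed_curves n xs ((i, Cup) # D) =
     (let ys = take i xs @ drop (i + 2) xs in
      if xs ! i = xs ! (i + 1) then 1 + closed_curves n ys D
      else closed_curves n (map (\<lambda>x. if x = xs ! (i + 1) then xs ! i else x) ys) D)"
| "closed_curves n xs ((i, Cross s) # D) =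
     closed_curves n (take i xs @ [xs ! (i + 1), xs ! i] @ drop (i + 2) xs) D"

definition components :: "'d diagram \<Rightarrow> nat" where
  "components D = closed_curves 0 [] D"

definition knot_diagram :: "bool diagram \<Rightarrow> bool" where
  "knot_diagram D \<longleftrightarrow> link_diagram D \<and> components D = 1"

text \<open>
  Isotopy of oriented links is the equivalence relation generated by planar isotopy (exchange of
  distant pieces, straightening of zigzags, sliding a strand past a cap or cup) and the
  Reidemeister moves, in the form of Turaev's moves for sliced diagrams.  The remaining variants
  (other curls, other crossing signs in the third move) follow from the ones listed.
\<close>

inductive local_move :: "'d diagram \<Rightarrow> 'd diagram \<Rightarrow> bool" where
  exchange: "local_move [(i, g), (i + outs g + k, h)] [(i + ins g + k, h), (i, g)]"
| zigzag_left: "local_move [(i + 1, Cap d), (i, Cup)] []"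
| zigzag_right: "local_move [(i, Cap d), (i + 1, Cup)] []"
| slide_cap: "local_move [(i, Cap d), (i + 1, Cross s)] [(i + 1, Cap d), (i, Cross (\<not> s))]"
| slide_cup: "local_move [(i + 1, Cross s), (i, Cup)] [(i, Cross (\<not> s)), (i + 1, Cup)]"
| reidemeister1: "local_move [(i + 1, Cap d), (i, Cross s), (i + 1, Cup)] []"
| reidemeister2: "local_move [(i, Cross s), (i, Cross (\<not> s))] []"
| reidemeister3: "local_move [(i, Cross s), (i + 1, Cross s), (i, Cross s)]
                             [(i + 1, Cross s), (i, Cross s), (i + 1, Cross s)]"

definition diagram_move :: "bool diagram \<Rightarrow> bool diagram \<Rightarrow> bool" where
  "diagram_move D E \<longleftrightarrow> link_diagram D \<and> link_diagram E \<and>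
     (\<exists>U l r V. local_move l r \<and> D = U @ l @ V \<and> E = U @ r @ V)"

definition isotopic :: "bool diagram \<Rightarrow> bool diagram \<Rightarrow> bool" where
  "isotopic = equivclp diagram_move"

text \<open>
  Sign of a slice with strand directions \<open>xs\<close> above it: \<open>Cross True\<close> is right-handed (positive) iff
  its strands both point downwards or both upwards.
\<close>

fun crossing_sign :: "bool list \<Rightarrow> nat \<times> 'd piece \<Rightarrow> int" where
  "crossing_sign xs (i, Cross s) = (if (xs ! i = xs ! (i + 1)) = s then 1 else - 1)"
| "crossing_sign xs (i, Cap d) = 0"
| "crossing_sign xs (i, Cup) = 0"

fun writhe_below :: "bool list \<Rightarrow> bool diagram \<Rightarrow> int" where
  "writhe_below xs [] = 0"
| "writhe_below xs (p # D) =
     crossing_sign xs p + (case through_slice p xs of None \<Rightarrow> 0 | Some ys \<Rightarrow> writhe_below ys D)"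

definition writhe :: "bool diagram \<Rightarrow> int" where
  "writhe D = writhe_below [] D"

subsection \<open>HOMFLY polynomial\<close>

text \<open>\<open>\<int>[a\<^sup>\<plusminus>\<^sup>1, m\<^sup>\<plusminus>\<^sup>1]\<close> as the group ring of \<open>\<int>\<^sup>2\<close>: the exponent \<open>(i, j)\<close> stands for \<open>a\<^sup>i m\<^sup>j\<close>.\<close>

type_synonym laurent2 = "(int \<times> int) \<Rightarrow>\<^sub>0 int"

definition oriented_smoothing :: "bool list \<Rightarrow> nat \<Rightarrow> bool diagram" where
  "oriented_smoothing xs i =
     (if xs ! i = xs ! (i + 1) then [] else [(i, Cup), (i, Cap (xs ! (i + 1)))])"

definition skein_triple :: "bool diagram \<Rightarrow> bool diagram \<Rightarrow> bool diagram \<Rightarrow> bool" where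
  "skein_triple Lp Lm L0 \<longleftrightarrow> link_diagram Lp \<and>
     (\<exists>U V xs i s. through U [] = Some xs \<and> crossing_sign xs (i, Cross s :: bool piece) = 1 \<and>
        Lp = U @ [(i, Cross s)] @ V \<and>
        Lm = U @ [(i, Cross (\<not> s))] @ V \<and>
        L0 = U @ oriented_smoothing xs i @ V)"

definition homfly_polynomial :: "(bool diagram \<Rightarrow> laurent2) \<Rightarrow> bool" where
  "homfly_polynomial P \<longleftrightarrow>
     (\<forall>D E. isotopic D E \<longrightarrow> P D = P E) \<and>
     (\<forall>d. P [(0, Cap d), (0, Cup)] = 1) \<and>
     (\<forall>Lp Lm L0. skein_triple Lp Lm L0 \<longrightarrow>
        Poly_Mapping.single (1, 0) 1 * P Lp + Poly_Mapping.single (- 1, 0) 1 * P Lm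
          + Poly_Mapping.single (0, 1) 1 * P L0 = 0)"

subsection \<open>Jones polynomial\<close>

type_synonym laurent = "int \<Rightarrow>\<^sub>0 int"

text \<open>
  The Kauffman states of a diagram, each with the number of A-smoothings minus the number of
  B-smoothings.  The A-smoothing of \<open>Cross True\<close> consists of two vertical strands.
\<close>

fun kauffman_states :: "unit diagram \<Rightarrow> (int \<times> unit diagram) list" where
  "kauffman_states [] = [(0, [])]"
| "kauffman_states ((i, Cross s) # D) =
     (let e = (if s then 1 else - 1) in
      map (\<lambda>(k, S). (k + e, S)) (kauffman_states D) @
      map (\<lambda>(k, S). (k - e, (i, Cup) # (i, Cap ()) # S)) (kauffman_states D))"
| "kauffman_states ((i, Cap d) # D) = map (\<lambda>(k, S). (k, (i, Cap d) # S)) (kauffman_states D)"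
| "kauffman_states ((i, Cup) # D) = map (\<lambda>(k, S). (k, (i, Cup) # S)) (kauffman_states D)"

definition kauffman_bracket :: "unit diagram \<Rightarrow> laurent" where
  "kauffman_bracket D = (\<Sum>(k, S) \<leftarrow> kauffman_states D. Poly_Mapping.single k 1 *
     (- Poly_Mapping.single 2 1 - Poly_Mapping.single (- 2) 1) ^ (components S - 1))"

text \<open>
  \<open>(-A\<^sup>3)\<^sup>-\<^sup>w \<langle>D\<rangle>\<close> with \<open>w\<close> the writhe, followed by the substitution \<open>A = t\<^sup>-\<^sup>1\<^sup>/\<^sup>4\<close>; the exponent \<open>n\<close>
  in the result stands for \<open>t\<^sup>n\<^sup>/\<^sup>4\<close>.
\<close>

definition jones_polynomial :: "bool diagram \<Rightarrow> laurent" where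
  "jones_polynomial D = Poly_Mapping.map_key uminus
     (Poly_Mapping.single (- 3 * writhe D) (if even (writhe D) then 1 else - 1)
        * kauffman_bracket (forget_orientation D))"

subsection \<open>Plats, bridge number, connected sum\<close>

text \<open>A braid word is a list of letters \<open>(i, s)\<close>: a crossing of the positions \<open>i\<close> and \<open>i + 1\<close>.\<close>

type_synonym braid_word = "(nat \<times> bool) list"

definition sigma_power :: "nat \<Rightarrow> int \<Rightarrow> braid_word" where
  "sigma_power i k = replicate (nat \<bar>k\<bar>) (i, k > 0)"

definition plat :: "nat \<Rightarrow> braid_word \<Rightarrow> unit diagram" where
  "plat n w = map (\<lambda>k. (2 * k, Cap ())) [0..<n] @ map (\<lambda>(i, s). (i, Cross s)) w
     @ map (\<lambda>k. (2 * k, Cup)) (rev [0..<n])"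

definition has_plat_presentation :: "bool diagram \<Rightarrow> nat \<Rightarrow> bool" where
  "has_plat_presentation K n \<longleftrightarrow>
     (\<exists>w E. (\<forall>(i, s) \<in> set w. i + 1 < 2 * n) \<and> orientation_of E (plat n w) \<and> isotopic E K)"

definition bridge_number :: "bool diagram \<Rightarrow> nat" where
  "bridge_number K = (LEAST n. has_plat_presentation K n)"

definition bridge_knot :: "nat \<Rightarrow> bool diagram \<Rightarrow> bool" where
  "bridge_knot n K \<longleftrightarrow> knot_diagram K \<and> bridge_number K = n"

text \<open>
  A nonempty closed diagram starts with a cap and ends with a cup, both at position 0.  The connected
  sum puts \<open>D\<close> above \<open>E\<close> and joins the two strands at the last cup of \<open>D\<close> to those at the first cap
  of \<open>E\<close>.  The result is a link diagram provided the directions of these strands agree.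
\<close>

definition connected_sum :: "bool diagram \<Rightarrow> bool diagram \<Rightarrow> bool diagram" where
  "connected_sum D E = butlast D @ tl E"

definition knot_8_9 :: "unit diagram" where
  "knot_8_9 = plat 2 (sigma_power 1 (- 3) @ sigma_power 2 1 @ sigma_power 1 (- 1)
     @ sigma_power 2 2 @ sigma_power 1 (- 1))"

definition knot_4_1 :: "unit diagram" where
  "knot_4_1 = plat 2 (sigma_power 1 (- 1) @ sigma_power 2 1 @ sigma_power 1 (- 2))"

end

theory Submission
  imports Defs "HOL-Library.Numeral_Type"
begin

text \<open>
  Bridge numbers: the number of Fox 5-colourings is an isotopy invariant, and a plat on \<open>2 n\<close>
  strings has at most \<open>5 ^ n\<close> of them because the colours of its \<open>n\<close> caps determine the rest.
  Both knots attain their bound, \<open>8_9\<close> with 25 colourings and the sum of two figure-eight knots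
  with 125.

  HOMFLY: \<open>4_1\<close> and \<open>8_9\<close> are the cases \<open>j = 0\<close> and \<open>j = 2\<close> of a family \<open>K\<^sub>j\<close> of 2-bridge knots.
  Changing the first \<open>\<sigma>\<^sub>2\<close> of \<open>K\<^sub>j\<close> gives the unknot, and smoothing it gives the connected sum of
  a negative \<open>(2, j + 1)\<close> and a positive \<open>(2, j + 2)\<close> torus link, on which the skein relation is a
  linear recursion.  Hence \<open>P(K\<^sub>j)\<close> has degree \<open>2 j + 2\<close> in \<open>m\<close>, so that \<open>P(8_9)\<close> has a term
  \<open>m\<^sup>6\<close> whereas \<open>P(4_1)\<^sup>2\<close> has degree 4.
\<close>

section \<open>Strand directions in tangles\<close>

lemma split_list_at:
  assumes "i + n \<le> length xs"
  obtains A ms C where "xs = A @ ms @ C" "i = length A" "length ms = n"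
proof
  show "xs = take i xs @ take n (drop i xs) @ drop n (drop i xs)"
    by (simp only: append_take_drop_id)
qed (use assms in auto)

lemma split_list_at1:
  assumes "i < length xs"
  obtains A x C where "xs = A @ x # C" "i = length A"
  using assms id_take_nth_drop[OF assms] by force

lemma split_list_at2:
  assumes "Suc i < length xs"
  obtains A x y C where "xs = A @ x # y # C" "i = length A"
proof -
  obtain A ms C where "xs = A @ ms @ C" "i = length A" "length ms = Suc (Suc 0)"
    using split_list_at[of i "Suc (Suc 0)" xs] assms by auto
  then show ?thesis
    using that by (auto simp: length_Suc_conv)
qed

lemma split_list_at3:
  assumes "Suc (Suc i) < length xs"
  obtains A x y z C where "xs = A @ x # y # z # C" "i = length A"
proof -
  obtain A ms C where "xs = A @ ms @ C" "i = length A" "length ms = Suc (Suc (Suc 0))"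
    using split_list_at[of i "Suc (Suc (Suc 0))" xs] assms by auto
  then show ?thesis
    using that by (auto simp: length_Suc_conv)
qed

lemma through_append: "through (S @ T) xs = Option.bind (through S xs) (through T)"
  by (induction S arbitrary: xs) (auto split: bind_split)

lemma length_through_slice:
  "through_slice (i, g) xs = Some ys \<Longrightarrow>
    i + ins g \<le> length xs \<and> length ys + ins g = length xs + outs g"
  by (cases g) (auto split: if_splits)

lemma through_slice_append:
  assumes "length ms = ins g"
  shows "through_slice (length A, g) (A @ ms @ C)
    = map_option (\<lambda>ns. A @ ns @ C) (through_slice (0, g) ms)"
  using assms by (cases g) (auto simp: numeral_2_eq_2 length_Suc_conv nth_append)

lemma through_slice_left:
  "through_slice (length A + k, g) (A @ C) = map_option ((@) A) (through_slice (k, g) C)"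
  by (cases g) (auto simp: nth_append)

lemmas through_slice_at =
  through_slice_left[of _ 0, simplified] through_slice.simps[where i = 0]
  through_slice_left[of _ "Suc 0", simplified] through_slice.simps[where i = "Suc 0"]
  through_slice_left[of _ 2, simplified] through_slice.simps[where i = 2]

lemma through_exchange_length:
  assumes "through [(i, g), (i + outs g + k, h)] xs \<noteq> None"
  shows "i + ins g + k + ins h \<le> length xs"
proof -
  obtain ys zs where "through_slice (i, g) xs = Some ys"
    "through_slice (i + outs g + k, h) ys = Some zs"
    using assms by (auto simp: bind_eq_Some_conv)
  from this[THEN length_through_slice] show ?thesis
    by linarith
qed

lemma local_move_strandsE:
  assumes "local_move l r" and "through l ys \<noteq> None" and "length xs = length ys"
  obtains
    (exchange) A g ms M h ns C where "xs = A @ ms @ M @ ns @ C"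
      "length ms = ins g" "length ns = ins h"
      "l = [(length A, g), (length A + outs g + length M, h)]"
      "r = [(length A + ins g + length M, h), (length A, g)]"
  | (zigzag_left) A x C d where "xs = A @ x # C"
      "l = [(length A + 1, Cap d), (length A, Cup)]" "r = []"
  | (zigzag_right) A x C d where "xs = A @ x # C"
      "l = [(length A, Cap d), (length A + 1, Cup)]" "r = []"
  | (slide_cap) A x C d s where "xs = A @ x # C"
      "l = [(length A, Cap d), (length A + 1, Cross s)]"
      "r = [(length A + 1, Cap d), (length A, Cross (\<not> s))]"
  | (slide_cup) A x y z C s where "xs = A @ x # y # z # C"
      "l = [(length A + 1, Cross s), (length A, Cup)]"
      "r = [(length A, Cross (\<not> s)), (length A + 1, Cup)]"
  | (reidemeister1) A x C d s where "xs = A @ x # C"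
      "l = [(length A + 1, Cap d), (length A, Cross s), (length A + 1, Cup)]" "r = []"
  | (reidemeister2) A x y C s where "xs = A @ x # y # C"
      "l = [(length A, Cross s), (length A, Cross (\<not> s))]" "r = []"
  | (reidemeister3) A x y z C s where "xs = A @ x # y # z # C"
      "l = [(length A, Cross s), (length A + 1, Cross s), (length A, Cross s)]"
      "r = [(length A + 1, Cross s), (length A, Cross s), (length A + 1, Cross s)]"
  using assms
proof (cases rule: local_move.cases)
  case (exchange i g k h)
  then have "i + ins g + k + ins h \<le> length xs"
    using assms(2,3) through_exchange_length by auto
  then obtain B ns C where xs: "xs = B @ ns @ C" "i + ins g + k = length B" "length ns = ins h"
    by (rule split_list_at)
  then obtain A ms M where "B = A @ ms @ M" "i = length A" "length ms = ins g"
    using split_list_at[of i "ins g" B] by auto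
  then show ?thesis
    using that(1)[of A ms M ns C g h] xs exchange by auto
next
  case (zigzag_left i d)
  then have "i < length xs"
    using assms(2,3) by (auto split: if_splits)
  with that(2) zigzag_left show ?thesis
    by (elim split_list_at1) auto
next
  case (zigzag_right i d)
  then have "i < length xs"
    using assms(2,3) by (auto split: if_splits)
  with that(3) zigzag_right show ?thesis
    by (elim split_list_at1) auto
next
  case (slide_cap i d s)
  then have "i < length xs"
    using assms(2,3) by (auto split: if_splits)
  with that(4) slide_cap show ?thesis
    by (elim split_list_at1) auto
next
  case (slide_cup i s)
  then have "Suc (Suc i) < length xs"
    using assms(2,3) by (auto split: if_splits)
  with that(5) slide_cup show ?thesis
    by (elim split_list_at3) auto
next
  case (reidemeister1 i d s)
  then have "i < length xs"
    using assms(2,3) by (auto split: if_splits)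
  with that(6) reidemeister1 show ?thesis
    by (elim split_list_at1) auto
next
  case (reidemeister2 i s)
  then have "Suc i < length xs"
    using assms(2,3) by (auto split: if_splits)
  with that(7) reidemeister2 show ?thesis
    by (elim split_list_at2) auto
next
  case (reidemeister3 i s)
  then have "Suc (Suc i) < length xs"
    using assms(2,3) by (auto split: if_splits)
  with that(8) reidemeister3 show ?thesis
    by (elim split_list_at3) auto
qed

lemma through_exchange:
  assumes ms: "length ms = ins g" and ns: "length ns = ins h"
  shows "through [(length A, g), (length A + outs g + length M, h)] (A @ ms @ M @ ns @ C)
    = through [(length A + ins g + length M, h), (length A, g)] (A @ ms @ M @ ns @ C)"
proof -
  have h: "through_slice (length A + ins g + length M, h) (A @ ms @ M @ ns @ C)
      = map_option (\<lambda>ns'. A @ ms @ M @ ns' @ C) (through_slice (0, h) ns)"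
    using through_slice_append[OF ns, of "A @ ms @ M" C] ms by (simp add: add.assoc)
  have g: "through_slice (length A, g) (A @ ms @ M @ ks @ C)
      = map_option (\<lambda>ms'. A @ ms' @ M @ ks @ C) (through_slice (0, g) ms)" for ks
    by (rule through_slice_append[OF ms])
  show ?thesis
  proof (cases "through_slice (0, g) ms")
    case None
    then show ?thesis
      by (cases "through_slice (0, h) ns") (simp_all add: g h)
  next
    case (Some ms')
    then have "length ms' = outs g"
      using length_through_slice ms by fastforce
    then have "through_slice (length A + outs g + length M, h) (A @ ms' @ M @ ns @ C)
        = map_option (\<lambda>ns'. A @ ms' @ M @ ns' @ C) (through_slice (0, h) ns)"
      using through_slice_append[OF ns, of "A @ ms' @ M" C] by (simp add: add.assoc)
    with Some show ?thesis
      by (cases "through_slice (0, h) ns") (simp_all add: g h)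
  qed
qed

context
  notes through_slice.simps [simp del] and through_slice_at [simp]
begin

lemma through_local_move:
  assumes "local_move l r" and "through l xs = Some ys"
  shows "through r xs = Some ys"
proof -
  have "through l xs \<noteq> None"
    using assms(2) by simp
  from assms(1) this refl show ?thesis
  proof (cases rule: local_move_strandsE)
    case (exchange A g ms M h ns C)
    then show ?thesis
      using assms(2) through_exchange by simp
  qed (use assms(2) in \<open>auto split: if_splits\<close>)
qed

end

section \<open>Isotopies of tangles\<close>

text \<open>
  Diagrams that do not fit below \<open>xs\<close> are deliberately not excluded: only the equality of
  directions makes isotopy a congruence whatever is attached below.
\<close>

definition tangle_move :: "bool list \<Rightarrow> bool diagram \<Rightarrow> bool diagram \<Rightarrow> bool" where
  "tangle_move xs S T \<longleftrightarrow> through S xs = through T xs \<and>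
     (\<exists>U l r V. local_move l r \<and> S = U @ l @ V \<and> T = U @ r @ V)"

definition tangle_isotopic :: "bool list \<Rightarrow> bool diagram \<Rightarrow> bool diagram \<Rightarrow> bool" where
  "tangle_isotopic xs = equivclp (tangle_move xs)"

lemma tangle_isotopic_refl [simp]: "tangle_isotopic xs S S"
  by (simp add: tangle_isotopic_def)

lemma tangle_isotopic_sym: "tangle_isotopic xs S T \<Longrightarrow> tangle_isotopic xs T S"
  unfolding tangle_isotopic_def by (rule equivclp_sym)

lemma tangle_isotopic_trans [trans]:
  "tangle_isotopic xs R S \<Longrightarrow> tangle_isotopic xs S T \<Longrightarrow> tangle_isotopic xs R T"
  unfolding tangle_isotopic_def by (rule equivclp_trans)

lemma through_tangle_isotopic:
  "tangle_isotopic xs S T \<Longrightarrow> through S xs = through T xs"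
  unfolding tangle_isotopic_def
  by (induction rule: equivclp_induct) (auto simp: tangle_move_def)

lemma tangle_move_context:
  assumes "tangle_move ys S T" and "through U xs = Some ys"
  shows "tangle_move xs (U @ S @ V) (U @ T @ V)"
proof -
  obtain A l r B where "local_move l r" "S = A @ l @ B" "T = A @ r @ B"
    using assms(1) by (auto simp: tangle_move_def)
  then have "\<exists>A l r B. local_move l r \<and> U @ S @ V = A @ l @ B \<and> U @ T @ V = A @ r @ B"
    by (metis append.assoc)
  then show ?thesis
    using assms by (simp add: tangle_move_def through_append)
qed

lemma tangle_isotopic_context:
  assumes "tangle_isotopic ys S T" and "through U xs = Some ys"
  shows "tangle_isotopic xs (U @ S @ V) (U @ T @ V)"
  using assms(1) unfolding tangle_isotopic_def
proof (induction rule: equivclp_induct)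
  case (step S' T')
  then show ?case
    using tangle_move_context[OF _ assms(2)] by (metis equivclp_into_equivclp)
qed simp

lemma tangle_isotopic_imp_isotopic:
  assumes "tangle_isotopic [] S T" and "link_diagram S"
  shows "isotopic S T"
  using assms(1) unfolding tangle_isotopic_def
proof (induction rule: equivclp_induct)
  case base
  show ?case
    by (simp add: isotopic_def)
next
  case (step T T')
  have "link_diagram T"
    using through_tangle_isotopic[of "[]" S T] step(1) assms(2)
    by (simp add: tangle_isotopic_def link_diagram_def)
  then have "diagram_move T T' \<or> diagram_move T' T"
    using step(2) by (auto simp: tangle_move_def diagram_move_def link_diagram_def)
  then show ?case
    using step(3) unfolding isotopic_def by (metis equivclp_into_equivclp)
qed

lemma tangle_isotopic_move:
  assumes "local_move l r" and "through (U @ l) xs \<noteq> None"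
  shows "tangle_isotopic xs (U @ l @ V) (U @ r @ V)"
proof -
  obtain ys zs where "through U xs = Some ys" "through l ys = Some zs"
    using assms(2) by (auto simp: through_append bind_eq_Some_conv)
  moreover from this have "through r ys = Some zs"
    using through_local_move assms(1) by blast
  ultimately have "tangle_move xs (U @ l @ V) (U @ r @ V)"
    using assms(1) by (auto simp: tangle_move_def through_append)
  then show ?thesis
    unfolding tangle_isotopic_def by (rule r_into_equivclp)
qed

lemmas tangle_isotopic_move_sym = tangle_isotopic_move[THEN tangle_isotopic_sym]

context
  notes through_slice.simps [simp del] and through_slice_at [simp]
begin

lemma tangle_isotopic_twisted_cap:
  assumes "i \<le> length xs"
  shows "tangle_isotopic xs [(i, Cap d), (i, Cross s)] [(i, Cap (\<not> d))]"
proof -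
  obtain A C where xs: "xs = A @ C" "i = length A"
    using assms by (metis append_take_drop_id length_take min.absorb2)
  have "tangle_isotopic xs [(i, Cap d), (i, Cross s)]
      [(i, Cap d), (i, Cross s), (i, Cap (\<not> d)), (i + 1, Cup)]"
    using tangle_isotopic_move_sym[OF zigzag_right, of "[(i, Cap d), (i, Cross s)]" i "\<not> d" xs
        "[]"]
    by (simp add: xs)
  also have "tangle_isotopic xs \<dots>
      [(i, Cap d), (i, Cap (\<not> d)), (i + 2, Cross s), (i + 1, Cup)]"
    using tangle_isotopic_move_sym[OF exchange, of "[(i, Cap d)]" i "Cap (\<not> d)" 0 "Cross s" xs
        "[(i + 1, Cup)]"]
    by (simp add: xs)
  also have "tangle_isotopic xs \<dots>
      [(i, Cap (\<not> d)), (i + 2, Cap d), (i + 2, Cross s), (i + 1, Cup)]"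
    using tangle_isotopic_move_sym[OF exchange, of "[]" i "Cap (\<not> d)" 0 "Cap d" xs
        "[(i + 2, Cross s), (i + 1, Cup)]"]
    by (simp add: xs)
  also have "tangle_isotopic xs \<dots>
      [(i, Cap (\<not> d)), (i + 2, Cap d), (i + 1, Cross (\<not> s)), (i + 2, Cup)]"
    using tangle_isotopic_move[OF slide_cup, of "[(i, Cap (\<not> d)), (i + 2, Cap d)]" "i + 1" s
        xs "[]"]
    by (simp add: xs)
  also have "tangle_isotopic xs \<dots> [(i, Cap (\<not> d))]"
    using tangle_isotopic_move[OF reidemeister1, of "[(i, Cap (\<not> d))]" "i + 1" d "\<not> s" xs "[]"]
    by (simp add: xs)
  finally show ?thesis .
qed

lemma tangle_isotopic_left_curl:
  assumes "i < length xs" and "xs ! i \<noteq> d"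
  shows "tangle_isotopic xs [(i, Cap d), (i + 1, Cross s), (i, Cup)] []"
proof -
  obtain A C where xs: "xs = A @ (\<not> d) # C" "i = length A"
    using assms by (elim split_list_at1) auto
  have "tangle_isotopic xs [(i, Cap d), (i + 1, Cross s), (i, Cup)]
      [(i, Cap d), (i, Cross (\<not> s)), (i + 1, Cup)]"
    using tangle_isotopic_move[OF slide_cup, of "[(i, Cap d)]" i s xs "[]"] by (simp add: xs)
  also have "tangle_isotopic xs \<dots> [(i, Cap (\<not> d)), (i + 1, Cup)]"
    using tangle_isotopic_context[OF tangle_isotopic_twisted_cap[of i xs d "\<not> s"],
        of "[]" xs "[(i + 1, Cup)]"]
    by (simp add: xs)
  also have "tangle_isotopic xs \<dots> []"
    using tangle_isotopic_move[OF zigzag_right, of "[]" i "\<not> d" xs "[]"] by (simp add: xs)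
  finally show ?thesis .
qed

lemma tangle_isotopic_cup_past_strand:
  assumes "Suc (Suc i) < length xs" and "xs ! i \<noteq> xs ! Suc i"
  shows "tangle_isotopic xs [(i, Cup)] [(i + 1, Cross s), (i, Cross s), (i + 1, Cup)]"
proof -
  obtain A x y z C where xs: "xs = A @ x # y # z # C" "i = length A"
    using assms(1) by (rule split_list_at3)
  have "tangle_isotopic xs [(i, Cup)] [(i + 1, Cross s), (i + 1, Cross (\<not> s)), (i, Cup)]"
    using tangle_isotopic_move_sym[OF reidemeister2, of "[]" "i + 1" s xs "[(i, Cup)]"]
    by (simp add: xs)
  also have "tangle_isotopic xs \<dots> [(i + 1, Cross s), (i, Cross s), (i + 1, Cup)]"
    using tangle_isotopic_move[OF slide_cup, of "[(i + 1, Cross s)]" i "\<not> s" xs "[]"] assms(2)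
    by (simp add: xs nth_append)
  finally show ?thesis .
qed

lemma tangle_isotopic_cup_past_two_strands:
  assumes "Suc (Suc (Suc i)) < length xs" and "xs ! i \<noteq> xs ! Suc i"
  shows "tangle_isotopic xs [(i, Cup)]
    [(i + 1, Cross s), (i, Cross s), (i + 2, Cross s), (i + 1, Cross s), (i + 2, Cup)]"
proof -
  obtain A v x y z C where xs: "xs = A @ v # x # y # z # C" "i = length A"
    using assms(1) split_list_at3[of "Suc i" xs]
    by (metis Suc_lessD append_Cons append_Nil append_assoc length_Suc_conv_rev)
  have "tangle_isotopic xs [(i, Cup)] [(i + 1, Cross s), (i, Cross s), (i + 1, Cup)]"
    using assms by (intro tangle_isotopic_cup_past_strand) simp_all
  also have "tangle_isotopic xs \<dots>
      [(i + 1, Cross s), (i, Cross s), (i + 2, Cross s), (i + 1, Cross s), (i + 2, Cup)]"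
    using tangle_isotopic_context[OF
        tangle_isotopic_cup_past_strand[of "Suc i" "A @ y # v # x # z # C" s],
        of "[(i + 1, Cross s), (i, Cross s)]" xs "[]"] assms(2)
    by (simp add: xs nth_append)
  finally show ?thesis .
qed

end

definition crossings :: "braid_word \<Rightarrow> 'd diagram" where
  "crossings w = map (\<lambda>(i, s). (i, Cross s)) w"

lemma crossings_simps [simp]:
  "crossings [] = []"
  "crossings ((i, s) # w) = (i, Cross s) # crossings w"
  "crossings (v @ w) = crossings v @ crossings w"
  "crossings (replicate n (i, s)) = replicate n (i, Cross s)"
  by (simp_all add: crossings_def)

lemma tangle_isotopic_crossings_past_piece:
  assumes "\<forall>(i, s) \<in> set w. i + 1 < n" and "through (crossings w @ [(n, h)]) xs \<noteq> None"
  shows "tangle_isotopic xs (crossings w @ [(n, h)]) ((n, h) # crossings w)"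
  using assms
proof (induction w arbitrary: xs)
  case (Cons p w)
  obtain i s where p: "p = (i, s)"
    by (cases p)
  have "i + 2 \<le> n"
    using Cons.prems(1) by (simp add: p)
  then obtain k where n: "n = i + 2 + k"
    using le_Suc_ex by blast
  obtain ys where ys: "through_slice (i, Cross s) xs = Some ys"
    "through (crossings w @ [(n, h)]) ys \<noteq> None"
    using Cons.prems(2) by (auto simp: p bind_eq_Some_conv simp del: through_slice.simps)
  have IH: "tangle_isotopic ys (crossings w @ [(n, h)]) ((n, h) # crossings w)"
    using Cons.IH Cons.prems(1) ys(2) by simp
  then have "tangle_isotopic xs ((i, Cross s) # crossings w @ [(n, h)])
      ((i, Cross s) # (n, h) # crossings w)"
    using tangle_isotopic_context[OF IH, of "[(i, Cross s)]" xs "[]"] ys(1)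
    by (simp del: through_slice.simps)
  also have "tangle_isotopic xs \<dots> ((n, h) # (i, Cross s) # crossings w)"
    using tangle_isotopic_move[OF exchange, of "[]" i "Cross s" k h xs "crossings w"] ys n
      through_tangle_isotopic[OF IH]
    by (auto simp: bind_eq_Some_conv simp del: through_slice.simps)
  finally show ?case
    by (simp add: p)
qed simp

section \<open>Plats\<close>

definition close_up :: "'d \<Rightarrow> 'd diagram \<Rightarrow> 'd diagram" where
  "close_up d T = (0, Cap d) # T @ [(0, Cup)]"

definition long_link :: "'d \<Rightarrow> braid_word \<Rightarrow> 'd diagram" where
  "long_link e w = (2, Cap e) # crossings w @ [(2, Cup)]"

lemma plat_2: "plat 2 w = close_up () (long_link () w)"
  by (simp add: plat_def close_up_def long_link_def upt_rec flip: crossings_def)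

lemma forget_orientation_simps [simp]:
  "forget_orientation [] = []"
  "forget_orientation ((i, g) # D) = (i, map_piece (\<lambda>_. ()) g) # forget_orientation D"
  "forget_orientation (D @ E) = forget_orientation D @ forget_orientation E"
  "forget_orientation (crossings w) = crossings w"
  by (auto simp: forget_orientation_def crossings_def)

lemma map_piece_eq_iff [simp]:
  "map_piece f g = Cup \<longleftrightarrow> g = Cup"
  "map_piece f g = Cross s \<longleftrightarrow> g = Cross s"
  "map_piece f g = Cap c \<longleftrightarrow> (\<exists>d. g = Cap d \<and> f d = c)"
  by (cases g; auto)+

lemma forget_orientation_eq_crossings:
  "forget_orientation D = crossings w \<longleftrightarrow> D = crossings w"
proof (induction w arbitrary: D)
  case Nil
  show ?case
    by (simp add: forget_orientation_def)
next
  case (Cons p w)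
  obtain i s where p: "p = (i, s)"
    by (cases p)
  show ?case
  proof (cases D)
    case (Cons q E)
    then show ?thesis
      using Cons.IH[of E] by (cases q) (simp add: p)
  qed (simp add: p)
qed

lemma orientation_of_plat_2E:
  assumes "orientation_of K (plat 2 w)"
  obtains d e where "K = close_up d (long_link e w)"
proof -
  have "map (map_prod id (map_piece (\<lambda>_. ()))) K
      = (0, Cap ()) # (2, Cap ()) # crossings w @ [(2, Cup), (0, Cup)]"
    using assms
    by (simp add: orientation_of_def forget_orientation_def plat_2 close_up_def long_link_def)
  then obtain d e D where "K = (0, Cap d) # (2, Cap e) # D @ [(2, Cup), (0, Cup)]"
    "forget_orientation D = crossings w"
    by (auto simp: map_eq_Cons_conv map_eq_append_conv forget_orientation_def
        eq_commute[of Cup] eq_commute[of "crossings w"])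
  then show ?thesis
    using that by (simp add: forget_orientation_eq_crossings close_up_def long_link_def)
qed

lemma connected_sum_close_up:
  "connected_sum (close_up d S) (close_up d T) = close_up d (S @ T)"
  by (simp add: connected_sum_def close_up_def)

lemma link_diagram_close_up:
  assumes "through T [d, \<not> d] = Some [d, \<not> d]"
  shows "link_diagram (close_up d T)"
  using assms by (simp add: link_diagram_def close_up_def through_append)

lemma forget_orientation_close_up [simp]:
  "forget_orientation (close_up d T) = close_up () (forget_orientation T)"
  by (simp add: close_up_def)

lemma through_slice_append_strands:
  "through_slice p xs = Some zs \<Longrightarrow> through_slice p (xs @ ys) = Some (zs @ ys)"
  by (cases "(p, xs)" rule: through_slice.cases) (auto simp: nth_append split: if_splits)

lemma through_append_strands:
  "through D xs = Some zs \<Longrightarrow> through D (xs @ ys) = Some (zs @ ys)"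
  by (induction D arbitrary: xs) (auto simp: bind_eq_Some_conv dest: through_slice_append_strands)

lemma length_through_crossings:
  "through (crossings w) xs = Some zs \<Longrightarrow> length zs = length xs"
proof (induction w arbitrary: xs)
  case (Cons p w)
  then show ?case
    by (cases p) (auto simp: bind_eq_Some_conv split: if_splits)
qed simp

lemma through_last_cupE:
  assumes "through [(n, Cup)] us = Some xs" and "length xs = n"
  obtains b where "us = xs @ [b, \<not> b]"
proof -
  have "Suc n < length us"
    using assms(1) by (auto split: if_splits)
  then obtain A x y C where "us = A @ x # y # C" "n = length A"
    by (rule split_list_at2)
  then show ?thesis
    using assms that by (auto simp: nth_append split: if_splits)
qed

lemma tangle_isotopic_cup_past_crossings:
  assumes w: "\<forall>(i, s) \<in> set w. i + 1 < n" and length: "length A = n"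
    and link: "through (crossings w) A \<noteq> None" and "x \<noteq> y"
  shows "tangle_isotopic (A @ x # y # C) ((n, Cup) # crossings w) (crossings w @ [(n, Cup)])"
proof -
  obtain B where B: "through (crossings w) A = Some B"
    using link by blast
  then have "through (crossings w) (A @ x # y # C) = Some (B @ x # y # C)" "length B = n"
    using length by (auto dest: through_append_strands length_through_crossings)
  then have "through (crossings w @ [(n, Cup)]) (A @ x # y # C) \<noteq> None"
    using \<open>x \<noteq> y\<close> by (simp add: through_append nth_append)
  then show ?thesis
    by (rule tangle_isotopic_sym[OF tangle_isotopic_crossings_past_piece[OF w]])
qed

lemma tangle_isotopic_separate_long_links:
  assumes w: "\<forall>(i, s) \<in> set w. i + 1 < 4"
    and link: "through (crossings w @ [(2, Cup)]) xs = Some [x, y]"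
  shows "tangle_isotopic xs (crossings w @ [(2, Cup), (2, Cap e)])
    ((4, Cap e) # crossings (w @ [(3, s), (2, s), (4, s), (3, s)]) @ [(4, Cup)])"
proof -
  obtain zs where zs: "through (crossings w) xs = Some zs" "through [(2, Cup)] zs = Some [x, y]"
    using link by (auto simp: through_append bind_eq_Some_conv)
  then obtain b where b: "zs = [x, y, b, \<not> b]"
    using through_last_cupE[of 2 zs "[x, y]"] by auto
  have "tangle_isotopic xs (crossings w @ [(2, Cup), (2, Cap e)])
      ((crossings w @ [(4, Cap e)]) @ [(2, Cup)])"
    using tangle_isotopic_move[OF exchange, of "crossings w" 2 Cup 0 "Cap e" xs "[]"] zs
    by (simp add: b through_append)
  also have "tangle_isotopic xs \<dots> ((4, Cap e) # crossings w @ [(2, Cup)])"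
    using tangle_isotopic_context[OF tangle_isotopic_crossings_past_piece[OF w, of "Cap e" xs],
        of "[]" xs] zs
    by (simp add: b through_append)
  also have "tangle_isotopic xs \<dots>
      ((4, Cap e) # crossings (w @ [(3, s), (2, s), (4, s), (3, s)]) @ [(4, Cup)])"
    using tangle_isotopic_context[OF tangle_isotopic_cup_past_two_strands[of 2 "zs @ [e, \<not> e]" s],
        of "(4, Cap e) # crossings w" xs "[]"] through_append_strands[OF zs(1), of "[e, \<not> e]"]
      length_through_crossings[OF zs(1)]
    by (simp add: b)
  finally show ?thesis .
qed

lemma tangle_isotopic_long_links:
  assumes w: "\<forall>(i, s) \<in> set w. i + 1 < 4" and w': "\<forall>(i, s) \<in> set w'. i + 1 < 4"
    and link: "through (long_link e w) [d, \<not> d] = Some [d, \<not> d]"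
    and link': "through (long_link e w') [d, \<not> d] \<noteq> None"
  shows "tangle_isotopic [d, \<not> d] (long_link e w @ long_link e w')
    ([(2, Cap e), (4, Cap e)] @ crossings (w @ [(3, s), (2, s), (4, s), (3, s)] @ w')
      @ [(4, Cup), (2, Cup)])"
proof -
  let ?v = "w @ [(3, s), (2, s), (4, s), (3, s)]"
  let ?xs = "[d, \<not> d, e, \<not> e]"
  have upper: "through (crossings w @ [(2, Cup)]) ?xs = Some [d, \<not> d]"
    using link by (simp add: long_link_def)
  then have separate: "tangle_isotopic ?xs (crossings w @ [(2, Cup), (2, Cap e)])
      ((4, Cap e) # crossings ?v @ [(4, Cup)])"
    by (rule tangle_isotopic_separate_long_links[OF w])
  then have "through (((4, Cap e) # crossings ?v) @ [(4, Cup)]) ?xs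
      = through ((crossings w @ [(2, Cup)]) @ [(2, Cap e)]) ?xs"
    by (simp add: through_tangle_isotopic)
  also have "\<dots> = Some ?xs"
    unfolding through_append[of _ "[(2, Cap e)]"] upper by simp
  finally obtain us where us: "through ((4, Cap e) # crossings ?v) ?xs = Some us"
    "through [(4, Cup)] us = Some ?xs"
    unfolding through_append[of "(4, Cap e) # crossings ?v"] bind_eq_Some_conv by blast
  then obtain b where b: "us = ?xs @ [b, \<not> b]"
    using through_last_cupE[of 4 us ?xs] by auto
  have "through (crossings w') ?xs \<noteq> None"
    using link' by (auto simp: long_link_def through_append bind_eq_Some_conv)
  then have past_cup: "tangle_isotopic us ((4, Cup) # crossings w') (crossings w' @ [(4, Cup)])"
    using tangle_isotopic_cup_past_crossings[OF w', of ?xs b "\<not> b" "[]"] by (simp add: b)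
  have "tangle_isotopic [d, \<not> d] (long_link e w @ long_link e w')
      ([(2, Cap e), (4, Cap e)] @ crossings ?v @ [(4, Cup)] @ crossings w' @ [(2, Cup)])"
    using tangle_isotopic_context[OF separate, of "[(2, Cap e)]" "[d, \<not> d]"
        "crossings w' @ [(2, Cup)]"]
    by (simp add: long_link_def)
  also have "tangle_isotopic [d, \<not> d] \<dots>
      ([(2, Cap e), (4, Cap e)] @ crossings (?v @ w') @ [(4, Cup), (2, Cup)])"
    using tangle_isotopic_context[OF past_cup,
        of "[(2, Cap e), (4, Cap e)] @ crossings ?v" "[d, \<not> d]"] us(1)
    by simp
  finally show ?thesis
    by simp
qed

lemma has_plat_presentation_long_links:
  assumes w: "\<forall>(i, s) \<in> set w. i + 1 < 4" and w': "\<forall>(i, s) \<in> set w'. i + 1 < 4"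
    and through: "through (long_link e w) [d, \<not> d] = Some [d, \<not> d]"
      "through (long_link e w') [d, \<not> d] = Some [d, \<not> d]"
  shows "has_plat_presentation (close_up d (long_link e w @ long_link e w')) 3"
proof -
  let ?v = "w @ [(3, False), (2, False), (4, False), (3, False)] @ w'"
  let ?T = "[(2, Cap e), (4, Cap e)] @ crossings ?v @ [(4, Cup), (2, Cup)]"
  let ?K = "close_up d (long_link e w @ long_link e w')" and ?E = "close_up d ?T"
  have K: "link_diagram ?K"
    using through by (intro link_diagram_close_up) (simp add: through_append)
  have "tangle_isotopic [] ?K ?E"
    unfolding close_up_def
    using tangle_isotopic_context[OF tangle_isotopic_long_links[OF w w' through(1), of False],
      of "[(0, Cap d)]" "[]" "[(0, Cup)]"] through(2) by simp
  then have "link_diagram ?E" "isotopic ?K ?E"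
    using K tangle_isotopic_imp_isotopic through_tangle_isotopic[of "[]" ?K ?E]
    by (auto simp: link_diagram_def)
  moreover have "forget_orientation ?E = plat 3 ?v"
    by (simp add: close_up_def plat_def upt_rec flip: crossings_def)
  moreover have "\<forall>(i, s) \<in> set ?v. i + 1 < 2 * 3"
    using w w' by fastforce
  moreover have "isotopic ?E ?K"
    using \<open>isotopic ?K ?E\<close> unfolding isotopic_def by (rule equivclp_sym)
  ultimately show ?thesis
    unfolding has_plat_presentation_def orientation_of_def by blast
qed

section \<open>A family of 2-bridge knots containing \<open>4_1\<close> and \<open>8_9\<close>\<close>

text \<open>As a plat, this is the knot with the palindromic Conway notation \<open>(j + 1) 1 1 (j + 1)\<close>.\<close>

definition palindromic_word :: "nat \<Rightarrow> braid_word" where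
  "palindromic_word j =
     replicate (Suc j) (1, False) @ (2, True) # (1, False) # replicate j (2, True) @ [(1, False)]"

lemma knot_4_1_eq_plat: "knot_4_1 = plat 2 (palindromic_word 0)"
  by (simp add: knot_4_1_def palindromic_word_def sigma_power_def numeral_2_eq_2)

lemma knot_8_9_eq_plat: "knot_8_9 = plat 2 (palindromic_word 2)"
  by (simp add: knot_8_9_def palindromic_word_def sigma_power_def eval_nat_numeral)

definition palindromic_arc :: "bool \<Rightarrow> nat \<Rightarrow> bool diagram" where
  "palindromic_arc d j = long_link (\<not> d) (palindromic_word j)"

lemmas close_up_palindromic_arc_defs =
  close_up_def palindromic_arc_def long_link_def palindromic_word_def

lemma through_replicate_crossings:
  "through (replicate n (length A, Cross s)) (A @ x # y # C)
    = Some (if even n then A @ x # y # C else A @ y # x # C)"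
  by (induction n arbitrary: x y) (simp_all add: nth_append)

lemmas through_replicate_crossings_1_2 =
  through_replicate_crossings[of _ "[b]" for b, simplified]
  through_replicate_crossings[of _ "[b, c]" for b c, simplified, folded numeral_2_eq_2]

lemma through_long_palindromic_word:
  "through (long_link e (palindromic_word j)) [d, \<not> d]
    = (if e = d then None else Some [d, \<not> d])"
  by (simp add: long_link_def palindromic_word_def through_append through_replicate_crossings_1_2
      del: replicate.simps)

lemma through_palindromic_arc [simp]:
  "through (palindromic_arc d j) [d, \<not> d] = Some [d, \<not> d]"
  by (simp add: palindromic_arc_def through_long_palindromic_word)

lemma orientation_of_palindromic_platE:
  assumes "orientation_of K (plat 2 (palindromic_word j))"
  obtains d where "K = close_up d (palindromic_arc d j)"
proof -
  obtain d e where K: "K = close_up d (long_link e (palindromic_word j))"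
    using assms by (rule orientation_of_plat_2E)
  then have "through (long_link e (palindromic_word j)) [d, \<not> d] \<noteq> None"
    using assms
    by (auto simp: orientation_of_def link_diagram_def close_up_def through_append
        bind_eq_Some_conv)
  then show ?thesis
    using K that
    by (auto simp: through_long_palindromic_word palindromic_arc_def split: if_splits)
qed

lemma forget_orientation_palindromic_arc [simp]:
  "forget_orientation (palindromic_arc d j) = long_link () (palindromic_word j)"
  by (simp add: palindromic_arc_def long_link_def)

lemma orientation_of_palindromic_arc:
  "orientation_of (close_up d (palindromic_arc d j)) (plat 2 (palindromic_word j))"
  by (simp add: orientation_of_def plat_2 link_diagram_close_up)

lemma has_plat_presentation_palindromic:
  "has_plat_presentation (close_up d (palindromic_arc d j)) 2"
  unfolding has_plat_presentation_def isotopic_def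
  using orientation_of_palindromic_arc[of d j]
  by (intro exI[of _ "palindromic_word j"] exI conjI) (auto simp: palindromic_word_def)

lemma has_plat_presentation_palindromic_sum:
  "has_plat_presentation (close_up d (palindromic_arc d j @ palindromic_arc d k)) 3"
  unfolding palindromic_arc_def
  by (intro has_plat_presentation_long_links)
    (simp_all add: through_long_palindromic_word, auto simp: palindromic_word_def)

lemma knot_diagram_8_9: "knot_diagram (close_up d (palindromic_arc d 2))"
proof -
  have "components (close_up d (palindromic_arc d 2)) = 1"
    by (simp add: close_up_palindromic_arc_defs components_def numeral_2_eq_2)
  then show ?thesis
    by (simp add: knot_diagram_def link_diagram_close_up)
qed

lemma knot_diagram_4_1_sum:
  "knot_diagram (close_up d (palindromic_arc d 0 @ palindromic_arc d 0))"
proof -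
  have "components (close_up d (palindromic_arc d 0 @ palindromic_arc d 0)) = 1"
    by (simp add: close_up_palindromic_arc_defs components_def)
  then show ?thesis
    by (simp add: knot_diagram_def link_diagram_close_up through_append)
qed

section \<open>Fox colourings and bridge numbers\<close>

fun cross_colours :: "bool \<Rightarrow> 'a::comm_ring_1 \<Rightarrow> 'a \<Rightarrow> 'a list" where
  "cross_colours True x y = [y, 2 * y - x]"
| "cross_colours False x y = [2 * x - y, x]"

lemma length_cross_colours [simp]: "length (cross_colours s x y) = 2"
  by (cases s) simp_all

text \<open>\<open>F\<close> counts the colourings of what lies below the piece, given the colours just below it.\<close>

fun colour_piece :: "'d piece \<Rightarrow> 'a::{finite,comm_ring_1} list \<Rightarrow> ('a list \<Rightarrow> nat) \<Rightarrow> nat" where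
  "colour_piece (Cap d) ms F = (\<Sum>c\<in>UNIV. F [c, c])"
| "colour_piece Cup ms F = (if ms ! 0 = ms ! 1 then F [] else 0)"
| "colour_piece (Cross s) ms F = F (cross_colours s (ms ! 0) (ms ! 1))"

fun colourings :: "'d diagram \<Rightarrow> 'a::{finite,comm_ring_1} list \<Rightarrow> nat" where
  "colourings [] xs = of_bool (xs = [])"
| "colourings ((i, g) # D) xs = colour_piece g (take (ins g) (drop i xs))
     (\<lambda>ns. colourings D (take i xs @ ns @ drop (i + ins g) xs))"

lemma colour_piece_commute:
  "colour_piece g ms (\<lambda>ms'. colour_piece h ns (F ms')) =
   colour_piece h ns (\<lambda>ns'. colour_piece g ms (\<lambda>ms'. F ms' ns'))"
  by (cases g; cases h) (auto intro: sum.swap)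

lemma colour_piece_cong:
  assumes "\<And>ns. length ns = outs g \<Longrightarrow> F ns = G ns"
  shows "colour_piece g ms F = colour_piece g ms G"
  using assms by (cases g) (auto intro: sum.cong)

lemma colourings_exchange:
  assumes "length ms = ins g" and "length ns = ins h"
  shows "colourings ((length A, g) # (length A + outs g + length M, h) # D) (A @ ms @ M @ ns @ C)
    = colourings ((length A + ins g + length M, h) # (length A, g) # D) (A @ ms @ M @ ns @ C)"
    (is "?above = ?below")
proof -
  let ?F = "\<lambda>ms' ns'. colourings D (A @ ms' @ M @ ns' @ C)"
  have "?above = colour_piece g ms (\<lambda>ms'. colour_piece h ns (?F ms'))"
    using assms by (auto intro!: colour_piece_cong)
  also have "\<dots> = colour_piece h ns (\<lambda>ns'. colour_piece g ms (\<lambda>ms'. ?F ms' ns'))"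
    by (rule colour_piece_commute)
  also have "\<dots> = ?below"
    using assms by simp
  finally show ?thesis .
qed

lemma colourings_local_move:
  fixes xs :: "'a::{finite,comm_ring_1} list"
  assumes "local_move l r" and "through l ys \<noteq> None" and "length xs = length ys"
  shows "colourings (l @ D) xs = colourings (r @ D) xs"
  using assms
proof (cases rule: local_move_strandsE)
  case (exchange A g ms M h ns C)
  then show ?thesis
    by (simp only: append_Cons append_Nil colourings_exchange)
next
  case (slide_cap A x C d s)
  then show ?thesis
    by (cases s) (auto intro!: sum.reindex_bij_witness[of _ "\<lambda>c. 2 * x - c" "\<lambda>c. 2 * x - c"])
next
  case (slide_cup A x y z C s)
  then show ?thesis
    by (cases s) (auto simp: algebra_simps)
next
  case (reidemeister1 A x C d s)
  have "2 * c - x = c \<longleftrightarrow> x = c" for c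
    by (auto simp: algebra_simps)
  with reidemeister1 show ?thesis
    by (cases s) simp_all
next
  case (reidemeister2 A x y C s)
  then show ?thesis
    by (cases s) simp_all
next
  case (reidemeister3 A x y z C s)
  then show ?thesis
    by (cases s) (simp_all add: algebra_simps)
qed simp_all

lemma colourings_append_cong:
  fixes xs :: "'a::{finite,comm_ring_1} list"
  assumes "through U zs = Some ys" and "length xs = length zs"
    and "\<And>xs :: 'a list. length xs = length ys \<Longrightarrow> colourings D xs = colourings E xs"
  shows "colourings (U @ D) xs = colourings (U @ E) xs"
  using assms(1,2)
proof (induction U arbitrary: zs xs)
  case Nil
  then show ?case
    using assms(3) by simp
next
  case (Cons p U)
  obtain i g where p: "p = (i, g)"
    by (cases p)
  obtain ws where ws: "through_slice (i, g) zs = Some ws" "through U ws = Some ys"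
    using Cons.prems p by (auto simp: bind_eq_Some_conv)
  have "length (take i xs @ ns @ drop (i + ins g) xs) = length ws" if "length ns = outs g" for ns
    using length_through_slice[OF ws(1)] Cons.prems(2) that by simp arith
  then show ?case
    by (auto simp: p intro!: colour_piece_cong Cons.IH[OF ws(2)])
qed

lemma colourings_diagram_move:
  assumes "diagram_move D E"
  shows "colourings D ([] :: 'a::{finite,comm_ring_1} list) = colourings E ([] :: 'a list)"
proof -
  obtain U l r V where move: "local_move l r" "D = U @ l @ V" "E = U @ r @ V" "link_diagram D"
    using assms unfolding diagram_move_def by blast
  obtain ys where ys: "through U [] = Some ys" "through l ys \<noteq> None"
    using move by (auto simp: link_diagram_def through_append bind_eq_Some_conv)
  show ?thesis
    unfolding move
    by (rule colourings_append_cong[OF ys(1)])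
      (use colourings_local_move[OF move(1) ys(2)] in auto)
qed

lemma colourings_isotopic:
  assumes "isotopic D E"
  shows "colourings D ([] :: 'a::{finite,comm_ring_1} list) = colourings E ([] :: 'a list)"
  using assms unfolding isotopic_def
  by (induction rule: equivclp_induct) (auto dest: colourings_diagram_move[where 'a = 'a])

fun caps :: "'d diagram \<Rightarrow> nat" where
  "caps [] = 0"
| "caps ((i, Cap d) # D) = Suc (caps D)"
| "caps ((i, Cup) # D) = caps D"
| "caps ((i, Cross s) # D) = caps D"

lemma caps_append: "caps (D @ E) = caps D + caps E"
  by (induction D rule: caps.induct) simp_all

lemma caps_forget_orientation: "caps (forget_orientation D) = caps D"
  by (induction D rule: caps.induct) (simp_all add: forget_orientation_def)

lemma caps_plat: "caps (plat n w) = n"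
proof -
  have "caps (map (\<lambda>k. (2 * k, Cap ())) ks) = length ks" for ks
    by (induction ks) simp_all
  moreover have "caps (map (\<lambda>k. (2 * k, Cup)) ks :: unit diagram) = 0" for ks
    by (induction ks) simp_all
  moreover have "caps (map (\<lambda>(i, s). (i, Cross s)) w :: unit diagram) = 0"
    by (induction w) auto
  ultimately show ?thesis
    by (simp add: plat_def caps_append)
qed

lemma colourings_le_caps:
  fixes xs :: "'a::{finite,comm_ring_1} list"
  shows "colourings D xs \<le> CARD('a) ^ caps D"
proof (induction D arbitrary: xs rule: caps.induct)
  case (2 i d D)
  then show ?case
    using sum_bounded_above[of UNIV "\<lambda>c. colourings D (take i xs @ c # c # drop i xs)"]
    by simp
qed simp_all

lemma colourings_le_plat:
  assumes "has_plat_presentation K n"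
  shows "colourings K ([] :: 'a::{finite,comm_ring_1} list) \<le> CARD('a) ^ n"
proof -
  obtain w E where E: "forget_orientation E = plat n w" "isotopic E K"
    using assms by (auto simp: has_plat_presentation_def orientation_of_def)
  then have "caps E = n"
    by (metis caps_forget_orientation caps_plat)
  then show ?thesis
    using colourings_le_caps[of E "[] :: 'a list"] colourings_isotopic[OF E(2), where 'a = 'a]
    by simp
qed

lemma bridge_number_eqI:
  assumes "has_plat_presentation K n"
    and "colourings K ([] :: 'a::{finite,comm_ring_1} list) = CARD('a) ^ n"
  shows "bridge_number K = n"
  unfolding bridge_number_def
proof (rule Least_equality)
  fix k assume "has_plat_presentation K k"
  then have "CARD('a) ^ n \<le> CARD('a) ^ k"
    using colourings_le_plat[of K k, where 'a = 'a] assms(2) by simp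
  moreover have "1 < CARD('a)"
    using card_mono[of UNIV "{0, 1 :: 'a}"] by simp
  ultimately show "n \<le> k"
    by (rule power_le_imp_le_exp[rotated])
qed (fact assms(1))

fun braid_action :: "braid_word \<Rightarrow> 'a::comm_ring_1 list \<Rightarrow> 'a list" where
  "braid_action [] xs = xs"
| "braid_action ((i, s) # w) xs =
     braid_action w (take i xs @ cross_colours s (xs ! i) (xs ! (i + 1)) @ drop (i + 2) xs)"

lemma map_cross_colours_affine:
  "map (\<lambda>k. c + of_int k * t) (cross_colours s x y)
    = cross_colours s (c + of_int x * t) (c + of_int y * t)"
  by (cases s) (simp_all add: algebra_simps)

lemma colourings_crossings:
  assumes "\<forall>(i, s) \<in> set w. i + 1 < length xs"
  shows "colourings (crossings w @ D) xs = colourings D (braid_action w xs)"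
  using assms
proof (induction w arbitrary: xs)
  case (Cons p w)
  obtain i s where p: "p = (i, s)"
    by (cases p)
  let ?ys = "take i xs @ cross_colours s (xs ! i) (xs ! (i + 1)) @ drop (i + 2) xs"
  have "colourings (crossings w @ D) ?ys = colourings D (braid_action w ?ys)"
    using Cons.prems by (intro Cons.IH) (auto simp: p)
  then show ?case
    using Cons.prems by (simp add: p)
qed simp

lemma braid_action_affine:
  assumes "\<forall>(i, s) \<in> set w. i + 1 < length ks"
  shows "braid_action w (map (\<lambda>k. c + of_int k * t) ks)
    = map (\<lambda>k. c + of_int k * t) (braid_action w ks)"
  using assms
proof (induction w arbitrary: ks)
  case (Cons p w)
  obtain i s where p: "p = (i, s)"
    by (cases p)
  let ?ls = "take i ks @ cross_colours s (ks ! i) (ks ! (i + 1)) @ drop (i + 2) ks"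
  have "braid_action w (map (\<lambda>k. c + of_int k * t) ?ls)
      = map (\<lambda>k. c + of_int k * t) (braid_action w ?ls)"
    using Cons.prems by (intro Cons.IH) (auto simp: p)
  then show ?case
    using Cons.prems by (simp add: p take_map drop_map map_cross_colours_affine)
qed simp

lemma colourings_long_link:
  fixes c :: "'a::{finite,comm_ring_1}"
  assumes "of_int n = (0 :: 'a)" and w: "\<forall>(i, s) \<in> set w. i + 1 < 4"
    and action: "braid_action w [0, 0, 1, 1] = [0, p, q, r :: int]" "n dvd p" "n dvd q - r"
  shows "colourings (long_link e w @ D) [c, c] = CARD('a) * colourings D [c, c]"
proof -
  have reduce: "of_int k = (0 :: 'a)" if "n dvd k" for k
    using that assms(1) by (auto simp: dvd_def)
  have "colourings (crossings w @ (2, Cup) # D) [c, c, b, b] = colourings D [c, c]" for b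
  proof -
    have "colourings (crossings w @ (2, Cup) # D) [c, c, b, b]
        = colourings ((2, Cup) # D) (map (\<lambda>k. c + of_int k * (b - c)) [0, p, q, r])"
      using braid_action_affine[of w "[0, 0, 1, 1]" c "b - c"] w
      by (simp add: colourings_crossings action(1) eval_nat_numeral)
    then show ?thesis
      using reduce[OF action(2)] reduce[OF action(3)] by simp
  qed
  then show ?thesis
    by (simp add: long_link_def)
qed

lemma colourings_palindromic_arc_5:
  "colourings (palindromic_arc d 0 @ D) [c, c] = 5 * colourings D [c, c :: 5]"
  "colourings (palindromic_arc d 2 @ D) [c, c] = 5 * colourings D [c, c :: 5]"
proof -
  have "braid_action (palindromic_word 0) [0, 0, 1, 1] = [0, -5, -3, 2 :: int]"
    by (simp add: palindromic_word_def)
  from colourings_long_link[OF _ _ this, of 5, where 'a = 5]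
  show "colourings (palindromic_arc d 0 @ D) [c, c] = 5 * colourings D [c, c :: 5]"
    by (simp add: palindromic_arc_def palindromic_word_def)
  have "braid_action (palindromic_word 2) [0, 0, 1, 1] = [0, -25, -7, 18 :: int]"
    by (simp add: palindromic_word_def numeral_2_eq_2)
  from colourings_long_link[OF _ _ this, of 5, where 'a = 5]
  show "colourings (palindromic_arc d 2 @ D) [c, c] = 5 * colourings D [c, c :: 5]"
    by (simp add: palindromic_arc_def palindromic_word_def)
qed

lemma colourings_close_up:
  assumes "\<And>c :: 'a. colourings (T @ [(0, Cup)]) [c, c] = k"
  shows "colourings (close_up d T) ([] :: 'a::{finite,comm_ring_1} list) = CARD('a) * k"
  using assms by (simp add: close_up_def)

lemma bridge_knot_8_9: "bridge_knot 2 (close_up d (palindromic_arc d 2))"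
proof -
  have "colourings (close_up d (palindromic_arc d 2)) ([] :: 5 list) = CARD(5) ^ 2"
    by (subst colourings_close_up) (simp_all add: colourings_palindromic_arc_5)
  then have "bridge_number (close_up d (palindromic_arc d 2)) = 2"
    by (rule bridge_number_eqI[OF has_plat_presentation_palindromic])
  then show ?thesis
    by (simp add: bridge_knot_def knot_diagram_8_9)
qed

lemma bridge_knot_4_1_sum:
  "bridge_knot 3 (close_up d (palindromic_arc d 0 @ palindromic_arc d 0))"
proof -
  have "colourings (close_up d (palindromic_arc d 0 @ palindromic_arc d 0)) ([] :: 5 list)
      = CARD(5) ^ 3"
    by (subst colourings_close_up) (simp_all add: colourings_palindromic_arc_5)
  then have "bridge_number (close_up d (palindromic_arc d 0 @ palindromic_arc d 0)) = 3"
    by (rule bridge_number_eqI[OF has_plat_presentation_palindromic_sum])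
  then show ?thesis
    by (simp add: bridge_knot_def knot_diagram_4_1_sum)
qed

section \<open>HOMFLY polynomials\<close>

lemma tangle_isotopic_changed_4_1:
  "tangle_isotopic [d, \<not> d]
     (long_link (\<not> d) [(1, False), (2, False), (1, False), (1, False)]) []"
proof -
  let ?n = "(1, Cross False) :: nat \<times> bool piece"
  have "tangle_isotopic [d, \<not> d] [(2, Cap (\<not> d)), ?n, (2, Cross False), ?n, ?n, (2, Cup)]
      [(1, Cap (\<not> d)), (2, Cross True), (2, Cross False), ?n, ?n, (2, Cup)]"
    using tangle_isotopic_move_sym[OF slide_cap, of "[]" 1 "\<not> d" True "[d, \<not> d]"
        "[(2, Cross False), ?n, ?n, (2, Cup)]"]
    by (simp add: numeral_2_eq_2)
  also have "tangle_isotopic [d, \<not> d] \<dots> [(1, Cap (\<not> d)), ?n, ?n, (2, Cup)]"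
    using tangle_isotopic_move[OF reidemeister2, of "[(1, Cap (\<not> d))]" 2 True "[d, \<not> d]"
        "[?n, ?n, (2, Cup)]"]
    by simp
  also have "tangle_isotopic [d, \<not> d] \<dots> [(1, Cap d), ?n, (2, Cup)]"
    using tangle_isotopic_context[OF tangle_isotopic_twisted_cap[of 1 "[d, \<not> d]" "\<not> d" False],
        of "[]" "[d, \<not> d]" "[?n, (2, Cup)]"]
    by simp
  also have "tangle_isotopic [d, \<not> d] \<dots> [(1, Cap (\<not> d)), (2, Cup)]"
    using tangle_isotopic_context[OF tangle_isotopic_twisted_cap[of 1 "[d, \<not> d]" d False],
        of "[]" "[d, \<not> d]" "[(2, Cup)]"]
    by simp
  also have "tangle_isotopic [d, \<not> d] \<dots> []"
    using tangle_isotopic_move[OF zigzag_right, of "[]" 1 "\<not> d" "[d, \<not> d]" "[]"]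
    by (simp add: numeral_2_eq_2)
  finally show ?thesis
    by (simp add: long_link_def)
qed

lemma tangle_isotopic_changed_palindromic_arc:
  "tangle_isotopic [d, \<not> d]
     (long_link (\<not> d) (replicate (Suc j) (1, False) @ (2, False) # (1, False)
       # replicate j (2, True) @ [(1, False)])) []"
proof (induction j)
  case 0
  show ?case
    using tangle_isotopic_changed_4_1[of d] by simp
next
  case (Suc j)
  let ?n = "(1, Cross False) :: nat \<times> bool piece" and ?p = "(2, Cross True) :: nat \<times> bool piece"
  let ?U = "(2, Cap (\<not> d)) # replicate (Suc j) ?n" and ?V = "replicate j ?p @ [?n, (2, Cup)]"
  have through_U: "through ?U [d, \<not> d] = Some [d, \<not> d, \<not> d, d]"
    by (simp add: through_replicate_crossings_1_2 del: replicate.simps)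
  have "tangle_isotopic [d, \<not> d] (?U @ [?n, (2, Cross False), ?n] @ ?p # ?V)
      (?U @ [(2, Cross False), ?n, (2, Cross False)] @ ?p # ?V)"
    using tangle_isotopic_move[OF reidemeister3, of ?U 1 False "[d, \<not> d]" "?p # ?V"] through_U
    by (simp add: through_append numeral_2_eq_2 del: replicate.simps)
  also have "tangle_isotopic [d, \<not> d] \<dots> (?U @ [(2, Cross False), ?n] @ ?V)"
    using tangle_isotopic_move[OF reidemeister2,
        of "?U @ [(2, Cross False), ?n]" 2 False "[d, \<not> d]" "?V"] through_U
    by (simp add: through_append del: replicate.simps)
  also have "tangle_isotopic [d, \<not> d] \<dots> []"
    using Suc by (simp add: long_link_def)
  finally show ?case
    by (simp add: long_link_def replicate_app_Cons_same)
qed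

lemma tangle_isotopic_clasp:
  "tangle_isotopic [d, \<not> d] (long_link d ((1, False) # replicate n (2, True) @ [(1, False)]))
     ((1, Cap d) # replicate (Suc (Suc n)) (2, Cross True) @ [(1, Cup)])"
proof -
  let ?n = "(1, Cross False) :: nat \<times> bool piece" and ?p = "(2, Cross True) :: nat \<times> bool piece"
  have "tangle_isotopic [d, \<not> d] ((2, Cap d) # ?n # replicate n ?p @ [?n, (2, Cup)])
      ((1, Cap d) # ?p # replicate n ?p @ [?n, (2, Cup)])"
    using tangle_isotopic_move_sym[OF slide_cap, of "[]" 1 d True "[d, \<not> d]"
        "replicate n ?p @ [?n, (2, Cup)]"]
    by (simp add: numeral_2_eq_2)
  also have "tangle_isotopic [d, \<not> d] \<dots>
      ((1, Cap d) # ?p # replicate n ?p @ [?p, (1, Cup)])"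
    using tangle_isotopic_move_sym[OF slide_cup, of "(1, Cap d) # replicate (Suc n) ?p" 1 True
      "[d, \<not> d]" "[]"]
      through_replicate_crossings[of "Suc n" "[d, d]" True "\<not> d" "\<not> d" "[]"]
    by (simp add: through_append numeral_2_eq_2)
  finally show ?thesis
    by (simp add: long_link_def replicate_app_Cons_same)
qed

abbreviation a :: laurent2 where "a \<equiv> Poly_Mapping.single (1, 0) 1"
abbreviation a_inv :: laurent2 where "a_inv \<equiv> Poly_Mapping.single (- 1, 0) 1"
abbreviation m :: laurent2 where "m \<equiv> Poly_Mapping.single (0, 1) 1"
abbreviation m_inv :: laurent2 where "m_inv \<equiv> Poly_Mapping.single (0, - 1) 1"

definition skein_unit :: "bool \<Rightarrow> laurent2" where
  "skein_unit e = (if e then a_inv else a)"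

text \<open>
  The \<open>(2, n)\<close> torus link with parallel strands and crossings of sign \<open>e\<close>; for \<open>n = 0\<close> it is the
  unlink of two components.
\<close>

fun torus_link_homfly :: "bool \<Rightarrow> nat \<Rightarrow> laurent2" where
  "torus_link_homfly e 0 = - m_inv * (a + a_inv)"
| "torus_link_homfly e (Suc 0) = 1"
| "torus_link_homfly e (Suc (Suc n)) = - skein_unit e *
     (skein_unit e * torus_link_homfly e n + m * torus_link_homfly e (Suc n))"

definition palindromic_homfly :: "nat \<Rightarrow> laurent2" where
  "palindromic_homfly j =
     - a * (a + m * (torus_link_homfly False (Suc j) * torus_link_homfly True (Suc (Suc j))))"

lemma inverse_units: "a_inv * a = 1" "a * a_inv = 1" "m_inv * m = 1"
  by (simp_all add: Poly_Mapping.mult_single flip: zero_prod_def)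

lemma unit_mult_add_eq_0_imp:
  fixes u v w x :: "'a::comm_ring_1"
  assumes "v * u = 1" and "u * x + w = 0"
  shows "x = - v * w"
proof -
  have "x = v * (u * x + w) - v * w"
    using assms(1) by (simp add: distrib_left flip: mult.assoc)
  then show ?thesis
    using assms(2) by simp
qed

lemma through_oriented_smoothing:
  assumes "Suc i < length xs"
  shows "through (oriented_smoothing xs i) xs = through_slice (i, Cross s) xs"
proof -
  obtain A x y C where "xs = A @ x # y # C" "i = length A"
    using assms by (rule split_list_at2)
  then show ?thesis
    by (auto simp: oriented_smoothing_def nth_append)
qed

context
  fixes P :: "bool diagram \<Rightarrow> laurent2"
  assumes homfly: "homfly_polynomial P"
begin

lemma homfly_skein_relation:
  assumes "link_diagram (U @ (i, Cross s) # V)" and "through U [] = Some xs"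
  shows "a * P (U @ (i, Cross (xs ! i = xs ! Suc i)) # V)
    + a_inv * P (U @ (i, Cross (xs ! i \<noteq> xs ! Suc i)) # V)
    + m * P (U @ oriented_smoothing xs i @ V) = 0"
proof -
  let ?e = "xs ! i = xs ! Suc i"
  have "link_diagram (U @ (i, Cross ?e) # V)"
    using assms by (simp add: link_diagram_def through_append)
  then have "skein_triple (U @ (i, Cross ?e) # V) (U @ (i, Cross (\<not> ?e)) # V)
      (U @ oriented_smoothing xs i @ V)"
    unfolding skein_triple_def using assms(2)
    by (intro conjI exI[of _ U] exI[of _ V] exI[of _ xs] exI[of _ i] exI[of _ ?e]) simp_all
  then show ?thesis
    using homfly unfolding homfly_polynomial_def by blast
qed

lemma homfly_crossing_change:
  assumes "link_diagram (U @ (i, Cross s) # V)" and "through U [] = Some xs"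
    and "e \<longleftrightarrow> (xs ! i = xs ! Suc i) = s"
  shows "P (U @ (i, Cross s) # V) = - skein_unit e *
    (skein_unit e * P (U @ (i, Cross (\<not> s)) # V) + m * P (U @ oriented_smoothing xs i @ V))"
proof (cases e)
  case True
  then show ?thesis
    using homfly_skein_relation[OF assms(1,2)] assms(3)
    by (intro unit_mult_add_eq_0_imp[of _ a])
      (auto simp: skein_unit_def inverse_units add.assoc)
next
  case False
  then show ?thesis
    using homfly_skein_relation[OF assms(1,2)] assms(3)
    by (intro unit_mult_add_eq_0_imp[of _ a_inv])
      (auto simp: skein_unit_def inverse_units ac_simps)
qed

text \<open>\<open>S\<close> equals \<open>p\<close> times \<open>T\<close> in the skein module of tangles.\<close>

definition skein_multiple :: "bool list \<Rightarrow> bool diagram \<Rightarrow> laurent2 \<Rightarrow> bool diagram \<Rightarrow> bool" where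
  "skein_multiple xs S p T \<longleftrightarrow> through S xs = through T xs \<and>
     (\<forall>U V. through U [] = Some xs \<longrightarrow> link_diagram (U @ S @ V) \<longrightarrow>
       P (U @ S @ V) = p * P (U @ T @ V))"

lemma skein_multiple_trans:
  assumes "skein_multiple xs R p S" and "skein_multiple xs S q T"
  shows "skein_multiple xs R (p * q) T"
  using assms by (simp add: skein_multiple_def link_diagram_def through_append mult.assoc)

lemma skein_multiple_context:
  assumes "skein_multiple ys S p T" and "through A xs = Some ys"
  shows "skein_multiple xs (A @ S @ B) p (A @ T @ B)"
  unfolding skein_multiple_def
proof (intro conjI allI impI)
  show "through (A @ S @ B) xs = through (A @ T @ B) xs"
    using assms by (simp add: skein_multiple_def through_append)
next
  fix U V assume "through U [] = Some xs" "link_diagram (U @ (A @ S @ B) @ V)"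
  then have "through (U @ A) [] = Some ys" "link_diagram ((U @ A) @ S @ B @ V)"
    using assms(2) by (simp_all add: through_append)
  then have "P ((U @ A) @ S @ B @ V) = p * P ((U @ A) @ T @ B @ V)"
    using assms(1) unfolding skein_multiple_def by blast
  then show "P (U @ (A @ S @ B) @ V) = p * P (U @ (A @ T @ B) @ V)"
    by simp
qed

lemma skein_multiple_append:
  assumes "skein_multiple xs S p []" and "skein_multiple xs T q []"
  shows "skein_multiple xs (S @ T) (p * q) []"
  using skein_multiple_trans[OF skein_multiple_context[OF assms(1), of "[]" xs T]] assms(2)
  by simp

lemma skein_multiple_isotopic:
  assumes "tangle_isotopic xs S T"
  shows "skein_multiple xs S 1 T"
  unfolding skein_multiple_def
proof (intro conjI allI impI)
  show "through S xs = through T xs"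
    using assms by (rule through_tangle_isotopic)
next
  fix U V assume "through U [] = Some xs" "link_diagram (U @ S @ V)"
  then have "isotopic (U @ S @ V) (U @ T @ V)"
    using tangle_isotopic_imp_isotopic tangle_isotopic_context[OF assms] by blast
  then show "P (U @ S @ V) = 1 * P (U @ T @ V)"
    using homfly by (simp add: homfly_polynomial_def)
qed

lemma skein_multiple_crossing_change:
  assumes "through A xs = Some zs" and "e \<longleftrightarrow> (zs ! i = zs ! Suc i) = s"
    and "skein_multiple xs (A @ (i, Cross (\<not> s)) # B) q T"
    and "skein_multiple xs (A @ oriented_smoothing zs i @ B) r T"
  shows "skein_multiple xs (A @ (i, Cross s) # B) (- skein_unit e * (skein_unit e * q + m * r)) T"
  unfolding skein_multiple_def
proof (intro conjI allI impI)
  show through: "through (A @ (i, Cross s) # B) xs = through T xs"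
    using assms(1,3) by (simp add: skein_multiple_def through_append)
  fix U V assume U: "through U [] = Some xs"
    and link: "link_diagram (U @ (A @ (i, Cross s) # B) @ V)"
  have "P (U @ (A @ (i, Cross (\<not> s)) # B) @ V) = q * P (U @ T @ V)"
    using assms(3) U link through unfolding skein_multiple_def link_diagram_def
    by (metis bind.bind_lunit through_append)
  moreover have "P (U @ (A @ oriented_smoothing zs i @ B) @ V) = r * P (U @ T @ V)"
    using assms(4) U link through unfolding skein_multiple_def link_diagram_def
    by (metis bind.bind_lunit through_append)
  moreover have "P ((U @ A) @ (i, Cross s) # B @ V) = - skein_unit e *
      (skein_unit e * P ((U @ A) @ (i, Cross (\<not> s)) # B @ V)
        + m * P ((U @ A) @ oriented_smoothing zs i @ B @ V))"
    using U link assms(1,2) by (intro homfly_crossing_change) (simp_all add: through_append)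
  ultimately show "P (U @ (A @ (i, Cross s) # B) @ V)
      = - skein_unit e * (skein_unit e * q + m * r) * P (U @ T @ V)"
    by (simp add: algebra_simps)
qed

lemma skein_multiple_smoothing:
  assumes "through A xs = Some zs" and "Suc i < length zs"
    and crossing: "\<And>s. skein_multiple xs (A @ (i, Cross s) # B) 1 T"
  shows "skein_multiple xs (A @ oriented_smoothing zs i @ B) (torus_link_homfly e 0) T"
  unfolding skein_multiple_def
proof (intro conjI allI impI)
  have same_through:
    "through (A @ oriented_smoothing zs i @ W) xs = through (A @ (i, Cross s) # W) xs" for s W
    using assms(1,2) by (simp add: through_append through_oriented_smoothing[where s = s])
  then show "through (A @ oriented_smoothing zs i @ B) xs = through T xs"
    using crossing[of True] by (simp add: skein_multiple_def)
  fix U V assume U: "through U [] = Some xs"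
    and "link_diagram (U @ (A @ oriented_smoothing zs i @ B) @ V)"
  then have link: "link_diagram (U @ (A @ (i, Cross s) # B) @ V)" for s
    using same_through[of "B @ V" s] by (simp add: link_diagram_def through_append[of U])
  have crossing_P: "P (U @ (A @ (i, Cross s) # B) @ V) = P (U @ T @ V)" for s
    using crossing[of s] U link[of s] by (simp add: skein_multiple_def)
  have "a * P (U @ T @ V) + a_inv * P (U @ T @ V)
      + m * P ((U @ A) @ oriented_smoothing zs i @ B @ V) = 0"
    using homfly_skein_relation[of "U @ A" i True "B @ V" zs] link[of True] U assms(1) crossing_P
    by (simp add: through_append)
  then have "P ((U @ A) @ oriented_smoothing zs i @ B @ V)
      = - m_inv * (a * P (U @ T @ V) + a_inv * P (U @ T @ V))"
    by (intro unit_mult_add_eq_0_imp[OF inverse_units(3)]) (simp add: ac_simps)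
  then show "P (U @ (A @ oriented_smoothing zs i @ B) @ V)
      = torus_link_homfly e 0 * P (U @ T @ V)"
    by (simp only: append_assoc torus_link_homfly.simps distrib_right mult.assoc)
qed

lemma skein_multiple_twist:
  assumes A: "through A xs = Some zs" and parallel: "Suc i < length zs" "zs ! i = zs ! Suc i"
    and crossing: "\<And>s. skein_multiple xs (A @ (i, Cross s) # B) 1 T"
  shows "skein_multiple xs (A @ replicate n (i, Cross s) @ B) (torus_link_homfly s n) T"
proof (induction s n rule: torus_link_homfly.induct)
  case (1 s)
  show ?case
    using skein_multiple_smoothing[OF A parallel(1) crossing, of s] parallel(2)
    by (simp add: oriented_smoothing_def del: torus_link_homfly.simps)
next
  case (2 s)
  show ?case
    using crossing by simp
next
  case (3 s n)
  have "tangle_isotopic xs (A @ [(i, Cross (\<not> s)), (i, Cross s)] @ replicate n (i, Cross s) @ B)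
      (A @ [] @ replicate n (i, Cross s) @ B)"
    using tangle_isotopic_move[OF reidemeister2, of A i "\<not> s"] A parallel(1)
    by (simp add: through_append)
  from skein_multiple_trans[OF skein_multiple_isotopic[OF this]] 3(1)
  have "skein_multiple xs (A @ (i, Cross (\<not> s)) # (i, Cross s) # replicate n (i, Cross s) @ B)
      (torus_link_homfly s n) T"
    by fastforce
  moreover have "skein_multiple xs
      (A @ oriented_smoothing zs i @ (i, Cross s) # replicate n (i, Cross s) @ B)
      (torus_link_homfly s (Suc n)) T"
    using 3(2) parallel(2) by (simp add: oriented_smoothing_def)
  ultimately show ?case
    using skein_multiple_crossing_change[OF A, of s i s] parallel(2) by simp
qed

lemma homfly_close_up:
  assumes "skein_multiple [d, \<not> d] T p []" and "through T [d, \<not> d] = Some [d, \<not> d]"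
  shows "P (close_up d T) = p"
proof -
  have "link_diagram ([(0, Cap d)] @ T @ [(0, Cup)])"
    using link_diagram_close_up[OF assms(2)] by (simp add: close_up_def)
  then have "P ([(0, Cap d)] @ T @ [(0, Cup)]) = p * P ([(0, Cap d)] @ [] @ [(0, Cup)])"
    using assms(1) by (simp add: skein_multiple_def del: append_Cons append_Nil)
  then show ?thesis
    using homfly by (simp add: homfly_polynomial_def close_up_def)
qed

lemma skein_multiple_right_twist:
  "skein_multiple [d, \<not> d] (long_link (\<not> d) (replicate n (1, s))) (torus_link_homfly s n) []"
proof -
  have "tangle_isotopic [d, \<not> d] ([(2, Cap (\<not> d))] @ (1, Cross t) # [(2, Cup)]) []" for t
    using tangle_isotopic_move[OF reidemeister1, of "[]" 1 "\<not> d" t "[d, \<not> d]" "[]"]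
    by (simp add: numeral_2_eq_2)
  from skein_multiple_twist[OF _ _ _ skein_multiple_isotopic[OF this],
      of "[d, \<not> d, \<not> d, d]" n s] show ?thesis
    by (simp add: long_link_def)
qed

lemma skein_multiple_left_twist:
  "skein_multiple [d, \<not> d] ((1, Cap d) # replicate n (2, Cross s) @ [(1, Cup)])
    (torus_link_homfly s n) []"
proof -
  have "tangle_isotopic [d, \<not> d] ([(1, Cap d)] @ (2, Cross t) # [(1, Cup)]) []" for t
    using tangle_isotopic_left_curl[of 1 "[d, \<not> d]" d t] by (simp add: numeral_2_eq_2)
  from skein_multiple_twist[OF _ _ _ skein_multiple_isotopic[OF this],
      of "[d, d, \<not> d, \<not> d]" n s] show ?thesis
    by simp
qed

lemma skein_multiple_palindromic_arc:
  "skein_multiple [d, \<not> d] (palindromic_arc d j) (palindromic_homfly j) []"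
proof -
  let ?A = "(2, Cap (\<not> d)) # replicate (Suc j) (1, Cross False)"
  let ?B = "(1, Cross False) # replicate j (2, Cross True) @ [(1, Cross False), (2, Cup)]"
  have through_A: "through ?A [d, \<not> d] = Some [d, \<not> d, \<not> d, d]"
    by (simp add: through_replicate_crossings_1_2 del: replicate.simps)
  have unknotted: "skein_multiple [d, \<not> d] (?A @ (2, Cross (\<not> True)) # ?B) 1 []"
    using skein_multiple_isotopic[OF tangle_isotopic_changed_palindromic_arc[of d j]]
    by (simp add: long_link_def)
  have smoothed: "skein_multiple [d, \<not> d] (?A @ oriented_smoothing [d, \<not> d, \<not> d, d] 2 @ ?B)
      (torus_link_homfly False (Suc j) * torus_link_homfly True (Suc (Suc j))) []"
    using skein_multiple_append[OF skein_multiple_right_twist skein_multiple_trans[OF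
        skein_multiple_isotopic[OF tangle_isotopic_clasp] skein_multiple_left_twist],
      of d "Suc j" False j]
    by (simp add: long_link_def oriented_smoothing_def del: torus_link_homfly.simps)
  have "skein_multiple [d, \<not> d] (?A @ (2, Cross True) # ?B)
    (- skein_unit False * (skein_unit False * 1 + m *
      (torus_link_homfly False (Suc j) * torus_link_homfly True (Suc (Suc j))))) []"
    by (rule skein_multiple_crossing_change[OF through_A _ unknotted smoothed]) simp
  then show ?thesis
    by (simp add: palindromic_arc_def palindromic_word_def long_link_def skein_unit_def
        palindromic_homfly_def del: torus_link_homfly.simps)
qed

lemma homfly_palindromic: "P (close_up d (palindromic_arc d j)) = palindromic_homfly j"
  by (intro homfly_close_up skein_multiple_palindromic_arc through_palindromic_arc)

lemma homfly_palindromic_sum: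
  "P (close_up d (palindromic_arc d j @ palindromic_arc d k))
    = palindromic_homfly j * palindromic_homfly k"
  by (intro homfly_close_up skein_multiple_append skein_multiple_palindromic_arc)
    (simp add: through_append)

end

lemma numeral_times_single:
  "numeral n * Poly_Mapping.single k c = Poly_Mapping.single k (numeral n * c :: int)"
  by (simp add: mult_single flip: single_numeral)

lemma lookup_palindromic_homfly:
  "Poly_Mapping.lookup (palindromic_homfly 2) (0, 6) = 1"
  "Poly_Mapping.lookup (palindromic_homfly 0 * palindromic_homfly 0) (0, 6) = 0"
  by (simp_all add: palindromic_homfly_def eval_nat_numeral skein_unit_def algebra_simps
      mult_single lookup_add lookup_single lookup_minus numeral_times_single)

lemma homfly_8_9_neq_4_1_sum:
  assumes "homfly_polynomial P"
  shows "P (close_up d (palindromic_arc d 2))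
    \<noteq> P (close_up e (palindromic_arc e 0 @ palindromic_arc e 0))"
  unfolding homfly_palindromic[OF assms] homfly_palindromic_sum[OF assms]
  using lookup_palindromic_homfly by (metis zero_neq_one)

section \<open>Jones polynomials\<close>

text \<open>
  Laurent polynomials as lists of terms with increasing exponents, a representation on which the
  state sum can be evaluated.
\<close>

fun add_term :: "'k::linorder \<times> 'c::plus \<Rightarrow> ('k \<times> 'c) list \<Rightarrow> ('k \<times> 'c) list" where
  "add_term (k, c) [] = [(k, c)]"
| "add_term (k, c) ((l, b) # p) =
     (if k = l then (k, b + c) # p else if k < l then (k, c) # (l, b) # p
      else (l, b) # add_term (k, c) p)"

definition mult_term :: "'k::plus \<times> 'c::times \<Rightarrow> ('k \<times> 'c) list \<Rightarrow> ('k \<times> 'c) list" where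
  "mult_term t p = map (\<lambda>(l, b). (fst t + l, snd t * b)) p"

definition poly_mapping_of :: "('k \<times> 'c) list \<Rightarrow> ('k \<Rightarrow>\<^sub>0 'c::comm_monoid_add)" where
  "poly_mapping_of p = (\<Sum>(k, c) \<leftarrow> p. Poly_Mapping.single k c)"

fun loop_power :: "nat \<Rightarrow> (int \<times> int) list" where
  "loop_power 0 = [(0, 1)]"
| "loop_power (Suc n) =
     (let p = loop_power n in fold add_term (mult_term (2, - 1) p) (mult_term (- 2, - 1) p))"

definition bracket_terms :: "unit diagram \<Rightarrow> (int \<times> int) list" where
  "bracket_terms D = filter (\<lambda>(k, c). c \<noteq> 0)
     (fold (\<lambda>(k, S). fold add_term (mult_term (k, 1) (loop_power (components S - 1))))
       (kauffman_states D) [])"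

lemma poly_mapping_of_simps [simp]:
  "poly_mapping_of [] = 0"
  "poly_mapping_of ((k, c) # p) = Poly_Mapping.single k c + poly_mapping_of p"
  by (simp_all add: poly_mapping_of_def)

lemma poly_mapping_of_add_term:
  "poly_mapping_of (add_term (k, c) p) = Poly_Mapping.single k c + poly_mapping_of p"
  by (induction "(k, c)" p rule: add_term.induct) (auto simp: single_add ac_simps)

lemma poly_mapping_of_fold_add_term:
  "poly_mapping_of (fold add_term p q) = poly_mapping_of p + poly_mapping_of q"
  by (induction p arbitrary: q) (auto simp: poly_mapping_of_add_term ac_simps)

lemma poly_mapping_of_mult_term:
  fixes c :: "'c::comm_ring_1"
  shows "poly_mapping_of (mult_term (k, c) p) = Poly_Mapping.single k c * poly_mapping_of p"
  by (induction p) (auto simp: mult_term_def mult_single distrib_left)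

lemma poly_mapping_of_filter:
  "poly_mapping_of (filter (\<lambda>(k, c). c \<noteq> 0) p) = poly_mapping_of p"
  by (induction p) auto

lemma poly_mapping_of_loop_power:
  "poly_mapping_of (loop_power n)
    = (- Poly_Mapping.single 2 1 - Poly_Mapping.single (- 2) 1) ^ n"
  by (induction n)
    (simp_all add: Let_def poly_mapping_of_fold_add_term poly_mapping_of_mult_term
      single_uminus left_diff_distrib)

lemma kauffman_bracket_eq_poly_mapping_of:
  "kauffman_bracket D = poly_mapping_of (bracket_terms D)"
proof -
  have "poly_mapping_of (fold (\<lambda>(k, S). fold add_term
        (mult_term (k, 1) (loop_power (components S - 1)))) states p)
      = (\<Sum>(k, S) \<leftarrow> states. Poly_Mapping.single k 1 *
          (- Poly_Mapping.single 2 1 - Poly_Mapping.single (- 2) 1) ^ (components S - 1))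
        + poly_mapping_of p" for states :: "(int \<times> unit diagram) list" and p
    by (induction states arbitrary: p)
      (auto simp: poly_mapping_of_fold_add_term poly_mapping_of_mult_term
        poly_mapping_of_loop_power ac_simps)
  then show ?thesis
    by (simp add: bracket_terms_def poly_mapping_of_filter kauffman_bracket_def)
qed

lemma bracket_terms_8_9_eq_4_1_sum:
  "bracket_terms (close_up () (long_link () (palindromic_word 2)))
    = bracket_terms (close_up ()
        (long_link () (palindromic_word 0) @ long_link () (palindromic_word 0)))"
  by code_simp

lemma jones_8_9_eq_4_1_sum:
  "jones_polynomial (close_up d (palindromic_arc d 2))
    = jones_polynomial (close_up e (palindromic_arc e 0 @ palindromic_arc e 0))"
proof -
  have "writhe (close_up d (palindromic_arc d 2)) = 0"
    by (simp add: close_up_palindromic_arc_defs writhe_def numeral_2_eq_2)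
  moreover have "writhe (close_up e (palindromic_arc e 0 @ palindromic_arc e 0)) = 0"
    by (simp add: close_up_palindromic_arc_defs writhe_def)
  ultimately show ?thesis
    by (simp add: jones_polynomial_def kauffman_bracket_eq_poly_mapping_of
        bracket_terms_8_9_eq_4_1_sum)
qed

theorem mainTheorem2:
  fixes K D :: "bool diagram"
  assumes "orientation_of K knot_8_9"
    and "orientation_of D knot_4_1"
  shows "bridge_knot 2 K \<and> bridge_knot 3 (connected_sum D D) \<and>
    jones_polynomial K = jones_polynomial (connected_sum D D) \<and>
    (\<forall>P. homfly_polynomial P \<longrightarrow> P K \<noteq> P (connected_sum D D))"
proof -
  obtain d where K: "K = close_up d (palindromic_arc d 2)"
    using assms(1) unfolding knot_8_9_eq_plat by (rule orientation_of_palindromic_platE)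
  obtain e where D: "D = close_up e (palindromic_arc e 0)"
    using assms(2) unfolding knot_4_1_eq_plat by (rule orientation_of_palindromic_platE)
  show ?thesis
    unfolding K D connected_sum_close_up
    using bridge_knot_8_9 bridge_knot_4_1_sum jones_8_9_eq_4_1_sum homfly_8_9_neq_4_1_sum by blast
qed

end
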